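(* Let $\omega$ be a nonempty open bounded subset of $\mathbb{R}^2$, and for $\mathbf{B}\in\mathbb{R}^3$ let $e(\mathbf{B},\omega)$ be the constant defined in the context. Then: (i) The map $\mathbf{B}\mapsto e(\mathbf{B},\omega)$ is a norm on $\mathbb{R}^3$ (depending on $\omega$). (ii) The map $(\mathbf{B},\omega)\mapsto e(\mathbf{B},\omega)$ is homogeneous: for every $\mathbf{B}\in\mathbb{R}^3\setminus\{0\}$, $$e(\mathbf{B},\omega)=|\omega|^{1/2}\,\|\mathbf{B}\|\;e(\mathbf{b},\varpi),\qquad\text{with}\quad \mathbf{b}=\frac{\mathbf{B}}{\|\mathbf{B}\|},\quad \varpi=\frac{\omega}{|\omega|^{1/2}}=\{|\omega|^{-1/2}x:\ x\in\omega\}.$$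
   Context: $|\omega|$ denotes the Lebesgue measure of $\omega$ and $\|\cdot\|$ the Euclidean norm. For $\mathbf{B}=(B_1,B_2,B_3)^{T}\in\mathbb{R}^3$ and $\omega\subset\mathbb{R}^2$ nonempty, open and bounded, set for $k=0,1,2$ $$m_{k}:=\frac{1}{|\omega|}\int_{\omega}x_1^{k}x_2^{2-k}\,dx_1\,dx_2$$ and $$e(\mathbf{B},\omega)=\left(B_3^2\,\frac{m_0m_2-m_1^2}{m_0+m_2}+B_2^2m_2+B_1^2m_0-2B_1B_2m_1\right)^{1/2}.$$ *)

theory Defs
  imports "HOL-Analysis.Analysis"
begin

definition is_norm :: "('a::real_vector \<Rightarrow> real) \<Rightarrow> bool" where
  "is_norm p \<longleftrightarrow>
     (\<forall>x. 0 \<le> p x) \<and>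
     (\<forall>x. p x = 0 \<longleftrightarrow> x = 0) \<and>
     (\<forall>c x. p (c *\<^sub>R x) = \<bar>c\<bar> * p x) \<and>
     (\<forall>x y. p (x + y) \<le> p x + p y)"

(* Only used for k = 0, 1, 2; for larger k the subtraction 2 - k on nat would truncate. *)
definition moment :: "(real^2) set \<Rightarrow> nat \<Rightarrow> real" where
  "moment \<omega> k =
     1 / measure lebesgue \<omega> * (LINT x:\<omega>|lebesgue. (x $ 1) ^ k * (x $ 2) ^ (2 - k))"

(* The library's sqrt is odd, not zero, on the negative reals, so a negative radicand
   would give a negative value. *)
definition e_const :: "real^3 \<Rightarrow> (real^2) set \<Rightarrow> real" where
  "e_const B \<omega> =
     (let m\<^sub>0 = moment \<omega> 0; m\<^sub>1 = moment \<omega> 1; m\<^sub>2 = moment \<omega> 2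
      in sqrt ((B $ 3)\<^sup>2 * ((m\<^sub>0 * m\<^sub>2 - m\<^sub>1\<^sup>2) / (m\<^sub>0 + m\<^sub>2))
               + (B $ 2)\<^sup>2 * m\<^sub>2 + (B $ 1)\<^sup>2 * m\<^sub>0 - 2 * B $ 1 * B $ 2 * m\<^sub>1))"

end

(* The numbers m_0, m_1, m_2 are the entries of the Gram matrix of x_2, x_1 in L^2(omega). The
   coordinates are linearly independent there because a line is a null set while a nonempty open
   set is not; so the Gram matrix is positive definite, and completing the square
     m_0 B_1^2 - 2 m_1 B_1 B_2 + m_2 B_2^2
       = m_0 (B_1 - (m_1 / m_0) B_2)^2 + ((m_0 m_2 - m_1^2) / m_0) B_2^2
   displays e as the Euclidean norm of an injective linear image of B. The radicand is
   homogeneous of degree 1 in (m_0, m_1, m_2), and the moments scale quadratically under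
   dilations, which gives (ii). *)
theory Submission
  imports Defs
begin

text \<open>This reduces the norm axioms, in particular the triangle inequality for the root of a
  quadratic form, to those of a known norm pulled back along a map with trivial kernel.\<close>

lemma is_norm_norm_comp_linear:
  fixes f :: "'a::real_vector \<Rightarrow> 'b::real_normed_vector"
  assumes "linear f" and "\<And>x. f x = 0 \<Longrightarrow> x = 0"
  shows "is_norm (\<lambda>x. norm (f x))"
  unfolding is_norm_def
  using assms by (auto simp: linear_0 linear_scale linear_add norm_triangle_ineq)

section \<open>Integrals and moments under dilations\<close>

lemma lebesgue_scaleR:
  assumes "c \<noteq> 0"
  shows "(lebesgue :: 'a::euclidean_space measure) =
    density (distr lebesgue lebesgue ((*\<^sub>R) c)) (\<lambda>_. ennreal (\<bar>c\<bar> ^ DIM('a)))"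
proof -
  \<comment> \<open>The general affine formula has one factor per coordinate axis; with all factors
    equal to \<open>c\<close> and no translation its map is the dilation.\<close>
  have "(\<lambda>x::'a. 0 + (\<Sum>j\<in>Basis. (c * (x \<bullet> j)) *\<^sub>R j)) = (*\<^sub>R) c"
    unfolding scaleR_scaleR[symmetric] scaleR_sum_right[symmetric] euclidean_representation
    by simp
  then show ?thesis
    using lebesgue_affine_euclidean[of "\<lambda>_::'a. c" 0] assms
    by (simp add: ennreal_power flip: prod_constant)
qed

lemma integral_lebesgue_scaleR:
  fixes f :: "'a::euclidean_space \<Rightarrow> real"
  assumes "c \<noteq> 0" and f: "f \<in> borel_measurable lebesgue"
  shows "(LINT x|lebesgue. f x) = \<bar>c\<bar> ^ DIM('a) * (LINT x|lebesgue. f (c *\<^sub>R x))"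
proof -
  have "(LINT x|lebesgue. f x) =
      (LINT x|density (distr lebesgue lebesgue ((*\<^sub>R) c)) (\<lambda>_. ennreal (\<bar>c\<bar> ^ DIM('a))). f x)"
    using lebesgue_scaleR[OF \<open>c \<noteq> 0\<close>, where 'a='a] by simp
  also have "\<dots> = (LINT x|distr lebesgue lebesgue ((*\<^sub>R) c). \<bar>c\<bar> ^ DIM('a) * f x)"
    using f by (subst integral_density) auto
  also have "\<dots> = (LINT x|lebesgue. \<bar>c\<bar> ^ DIM('a) * f (c *\<^sub>R x))"
    using f by (subst integral_distr) auto
  finally show ?thesis
    by simp
qed

lemma set_integral_scaleR_image:
  fixes f :: "'a::euclidean_space \<Rightarrow> real"
  assumes "c \<noteq> 0" and "(*\<^sub>R) c ` S \<in> sets lebesgue" and "f \<in> borel_measurable lebesgue"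
  shows "(LINT x:(*\<^sub>R) c ` S|lebesgue. f x) = \<bar>c\<bar> ^ DIM('a) * (LINT x:S|lebesgue. f (c *\<^sub>R x))"
proof -
  \<comment> \<open>Injectivity of the dilation, from \<open>c \<noteq> 0\<close>.\<close>
  have "indicat_real ((*\<^sub>R) c ` S) (c *\<^sub>R x) = indicat_real S x" for x
    using \<open>c \<noteq> 0\<close> by (auto simp: indicator_def)
  moreover have "(\<lambda>x. indicat_real ((*\<^sub>R) c ` S) x *\<^sub>R f x) \<in> borel_measurable lebesgue"
    using assms by measurable
  ultimately show ?thesis
    unfolding set_lebesgue_integral_def
    by (subst integral_lebesgue_scaleR[OF \<open>c \<noteq> 0\<close>]) auto
qed

lemma measure_lebesgue_scaleR_image:
  "measure lebesgue ((*\<^sub>R) c ` (S :: 'a::euclidean_space set)) = \<bar>c\<bar> ^ DIM('a) * measure lebesgue S"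
  using measure_lebesgue_affine[of c 0 S] by simp

text \<open>The integrand is homogeneous of degree 2 and area in the plane gains
  \<open>c\<^sup>2\<close>, so the integral gains \<open>c^4\<close>; dividing by the area leaves
  \<open>c\<^sup>2\<close>. The bound on \<open>k\<close> makes the exponents add up to 2.\<close>

lemma moment_scaleR_image:
  assumes "open \<omega>" and "c \<noteq> 0" and "k \<le> 2"
  shows "moment ((*\<^sub>R) c ` \<omega>) k = c\<^sup>2 * moment \<omega> k"
proof -
  have "(*\<^sub>R) c ` \<omega> \<in> sets lebesgue"
    using open_scaling[OF \<open>c \<noteq> 0\<close> \<open>open \<omega>\<close>] by (simp add: borel_open sets_completionI_sets)
  moreover have "(\<lambda>x::real^2. (x $ 1) ^ k * (x $ 2) ^ (2 - k)) \<in> borel_measurable lebesgue"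
    by (intro borel_measurable_continuous_onI measurable_completion continuous_intros) simp
  moreover have "(c *\<^sub>R x) $ 1 ^ k * (c *\<^sub>R x) $ 2 ^ (2 - k) = c\<^sup>2 * (x $ 1 ^ k * x $ 2 ^ (2 - k))"
    for x :: "real^2"
    using \<open>k \<le> 2\<close> by (simp add: power_mult_distrib flip: power_add[of c k "2 - k"])
  ultimately show ?thesis
    unfolding moment_def using \<open>c \<noteq> 0\<close>
    by (simp add: set_integral_scaleR_image measure_lebesgue_scaleR_image power4_eq_xxxx power2_eq_square)
qed

section \<open>Integrability and strict positivity\<close>

lemma set_integrable_continuous_bounded:
  fixes f :: "'a::euclidean_space \<Rightarrow> real"
  assumes "continuous_on UNIV f" and "bounded S" and "S \<in> sets lebesgue"
  shows "set_integrable lebesgue S f"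
proof -
  obtain a b where "S \<subseteq> cbox a b"
    using bounded_subset_cbox_symmetric[OF \<open>bounded S\<close>] by blast
  moreover have "set_integrable lebesgue (cbox a b) f"
    using assms(1) by (blast intro: absolutely_integrable_continuous continuous_on_subset)
  ultimately show ?thesis
    using assms(3) by (blast intro: set_integrable_subset)
qed

text \<open>A vanishing integral would force \<open>f\<close> to vanish almost everywhere on
  \<open>S\<close>; its zeros being negligible, \<open>S\<close> would be negligible too.\<close>

lemma set_integral_pos:
  fixes f :: "'a::euclidean_space \<Rightarrow> real"
  assumes "set_integrable lebesgue S f" and "\<And>x. 0 \<le> f x"
    and "negligible {x. f x = 0}" and "\<not> negligible S"
  shows "0 < (LINT x:S|lebesgue. f x)"
proof (rule ccontr)
  assume "\<not> ?thesis"
  moreover have "0 \<le> (LINT x:S|lebesgue. f x)"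
    using assms(2) by (simp add: set_lebesgue_integral_def)
  ultimately have "(LINT x:S|lebesgue. f x) = 0"
    by linarith
  then have "AE x in lebesgue. indicat_real S x *\<^sub>R f x = 0"
    using assms(1,2) unfolding set_lebesgue_integral_def set_integrable_def
    by (subst (asm) integral_nonneg_eq_0_iff_AE) auto
  moreover have "AE x in lebesgue. f x \<noteq> 0"
    using assms(3) AE_not_in[of "{x. f x = 0}" lebesgue] by (simp add: negligible_iff_null_sets)
  ultimately have "AE x in lebesgue. x \<notin> S"
    by eventually_elim (auto simp: indicator_def)
  \<comment> \<open>So \<open>S\<close> lies in a null set, and completeness of the measure makes it
    null itself.\<close>
  then show False
    using assms(4) null_sets_completion_subset
    by (auto simp: negligible_iff_null_sets eventually_ae_filter)
qed

text \<open>Boundedness keeps the measure finite; \<open>measure\<close> would return 0 for an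
  infinite one.\<close>

lemma measure_lebesgue_open_pos:
  fixes S :: "'a::euclidean_space set"
  assumes "open S" and "bounded S" and "S \<noteq> {}"
  shows "0 < measure lebesgue S"
  using open_not_negligible[OF assms(1,3)] lmeasurable_open[OF assms(2,1)] measure_nonneg[of lebesgue S]
  by (simp add: negligible_iff_measure less_le)

section \<open>The moment form and the norm property\<close>

context
  fixes \<omega> :: "(real^2) set"
  assumes \<omega>: "open \<omega>" "bounded \<omega>" "\<omega> \<noteq> {}"
begin

text \<open>The form is the average over \<open>\<omega>\<close> of the square of
  \<open>a * x $ 1 + b * x $ 2\<close>, which vanishes only on a line.\<close>

lemma moment_form_pos:
  assumes "a \<noteq> 0 \<or> b \<noteq> 0"
  shows "0 < a\<^sup>2 * moment \<omega> 2 + 2 * a * b * moment \<omega> 1 + b\<^sup>2 * moment \<omega> 0"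
proof -
  let ?I = "\<lambda>f::real^2 \<Rightarrow> real. LINT x:\<omega>|lebesgue. f x"
  have meas: "\<omega> \<in> sets lebesgue"
    using \<omega>(1) by (simp add: borel_open sets_completionI_sets)
  have int: "set_integrable lebesgue \<omega> f" if "continuous_on UNIV f" for f :: "real^2 \<Rightarrow> real"
    using set_integrable_continuous_bounded[OF that \<omega>(2) meas] .
  have "0 < ?I (\<lambda>x. (a * x $ 1 + b * x $ 2)\<^sup>2)"
  proof (rule set_integral_pos)
    have "vector [a, b] \<noteq> (0 :: real^2)"
      using assms by (auto simp: vec_eq_iff forall_2)
    then have "negligible {x :: real^2. vector [a, b] \<bullet> x = 0}"
      by (intro negligible_hyperplane) simp
    then show "negligible {x :: real^2. (a * x $ 1 + b * x $ 2)\<^sup>2 = 0}"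
      by (simp add: inner_vec_def sum_2)
  qed (use open_not_negligible[OF \<omega>(1,3)] in \<open>auto intro!: int continuous_intros\<close>)
  also have "(\<lambda>x::real^2. (a * x $ 1 + b * x $ 2)\<^sup>2) =
      (\<lambda>x. a\<^sup>2 * (x $ 1)\<^sup>2 + 2 * a * b * (x $ 1 * x $ 2) + b\<^sup>2 * (x $ 2)\<^sup>2)"
    by (simp add: fun_eq_iff power2_eq_square algebra_simps)
  also have "?I \<dots> = a\<^sup>2 * ?I (\<lambda>x. (x $ 1)\<^sup>2) + 2 * a * b * ?I (\<lambda>x. x $ 1 * x $ 2)
      + b\<^sup>2 * ?I (\<lambda>x. (x $ 2)\<^sup>2)"
    by (subst set_integral_add, (intro int continuous_intros)+)+ simp
  finally show ?thesis
    using divide_pos_pos[OF _ measure_lebesgue_open_pos[OF \<omega>]]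
    by (fastforce simp: moment_def add_divide_distrib)
qed

lemma moments_pos:
  shows moment_0_pos: "0 < moment \<omega> 0" and moment_2_pos: "0 < moment \<omega> 2"
    and moment_det_pos: "0 < moment \<omega> 0 * moment \<omega> 2 - (moment \<omega> 1)\<^sup>2"
proof -
  show m0: "0 < moment \<omega> 0" and "0 < moment \<omega> 2"
    using moment_form_pos[of 0 1] moment_form_pos[of 1 0] by simp_all
  \<comment> \<open>For \<open>a = moment \<omega> 0\<close> the form is minimal in \<open>b\<close>
    at \<open>- moment \<omega> 1\<close>, where its value is this product.\<close>
  have "0 < moment \<omega> 0 * (moment \<omega> 0 * moment \<omega> 2 - (moment \<omega> 1)\<^sup>2)"
    using moment_form_pos[of "moment \<omega> 0" "- moment \<omega> 1"] m0
    by (simp add: power2_eq_square algebra_simps)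
  then show "0 < moment \<omega> 0 * moment \<omega> 2 - (moment \<omega> 1)\<^sup>2"
    using m0 by (simp add: zero_less_mult_iff)
qed

lemma is_norm_e_const: "is_norm (\<lambda>B. e_const B \<omega>)"
proof -
  define m0 m1 m2 where m: "m0 = moment \<omega> 0" "m1 = moment \<omega> 1" "m2 = moment \<omega> 2"
  define p where "p = (m0 * m2 - m1\<^sup>2) / m0"
  define q where "q = (m0 * m2 - m1\<^sup>2) / (m0 + m2)"
  have pos: "0 < m0" "0 < m2" "0 < p" "0 < q"
    using moments_pos by (simp_all add: m p_def q_def)
  \<comment> \<open>The map is triangular with positive diagonal, hence injective; the product norm
    on triples is Euclidean, so the roots turn its square into the completed square.\<close>
  define f :: "real^3 \<Rightarrow> real \<times> real \<times> real"
    where "f B = (sqrt m0 * (B $ 1 - m1 / m0 * B $ 2), sqrt p * B $ 2, sqrt q * B $ 3)" for B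
  have "linear f"
    by (rule linearI) (simp_all add: f_def algebra_simps)
  moreover have "B = 0" if "f B = 0" for B
    using that pos by (simp add: f_def zero_prod_def vec_eq_iff forall_3)
  moreover have "e_const B \<omega> = norm (f B)" for B
  proof -
    have radicand: "(B $ 3)\<^sup>2 * q + (B $ 2)\<^sup>2 * m2 + (B $ 1)\<^sup>2 * m0 - 2 * B $ 1 * B $ 2 * m1 =
        m0 * (B $ 1 - m1 / m0 * B $ 2)\<^sup>2 + (p * (B $ 2)\<^sup>2 + q * (B $ 3)\<^sup>2)"
      using pos(1) by (simp add: p_def power2_eq_square field_simps)
    have "norm (f B) = sqrt (m0 * (B $ 1 - m1 / m0 * B $ 2)\<^sup>2 + (p * (B $ 2)\<^sup>2 + q * (B $ 3)\<^sup>2))"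
      using pos by (simp add: f_def norm_Pair power_mult_distrib)
    then show ?thesis
      unfolding e_const_def Let_def m[symmetric] q_def[symmetric] radicand by simp
  qed
  ultimately show ?thesis
    using is_norm_norm_comp_linear[of f] by simp
qed

end

section \<open>Behaviour of e under dilations\<close>

lemma e_const_scaleR_image:
  assumes "open \<omega>" and "c \<noteq> 0"
  shows "e_const B ((*\<^sub>R) c ` \<omega>) = \<bar>c\<bar> * e_const B \<omega>"
proof -
  \<comment> \<open>Degree 2 over degree 1 in the moments. Only \<open>c\<^sup>2\<close> is
    cancelled, so the identity persists for \<open>x + z = 0\<close>, where both sides are
    0.\<close>
  have ratio: "(c\<^sup>2 * x * (c\<^sup>2 * z) - (c\<^sup>2 * y)\<^sup>2) / (c\<^sup>2 * x + c\<^sup>2 * z) =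
      c\<^sup>2 * ((x * z - y\<^sup>2) / (x + z))"
    for x y z :: real
  proof -
    have "(c\<^sup>2 * x * (c\<^sup>2 * z) - (c\<^sup>2 * y)\<^sup>2) / (c\<^sup>2 * x + c\<^sup>2 * z) =
        (c\<^sup>2 * (c\<^sup>2 * (x * z - y\<^sup>2))) / (c\<^sup>2 * (x + z))"
      by (simp add: power2_eq_square algebra_simps)
    also have "\<dots> = c\<^sup>2 * (x * z - y\<^sup>2) / (x + z)"
      using \<open>c \<noteq> 0\<close> by (intro nonzero_mult_divide_mult_cancel_left) simp
    finally show ?thesis
      by simp
  qed
  have scale: "moment ((*\<^sub>R) c ` \<omega>) 0 = c\<^sup>2 * moment \<omega> 0"
    "moment ((*\<^sub>R) c ` \<omega>) 1 = c\<^sup>2 * moment \<omega> 1"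
    "moment ((*\<^sub>R) c ` \<omega>) 2 = c\<^sup>2 * moment \<omega> 2"
    using assms by (simp_all add: moment_scaleR_image)
  have "e_const B ((*\<^sub>R) c ` \<omega>) = sqrt (c\<^sup>2 *
      ((B $ 3)\<^sup>2 * ((moment \<omega> 0 * moment \<omega> 2 - (moment \<omega> 1)\<^sup>2) / (moment \<omega> 0 + moment \<omega> 2))
      + (B $ 2)\<^sup>2 * moment \<omega> 2 + (B $ 1)\<^sup>2 * moment \<omega> 0 - 2 * B $ 1 * B $ 2 * moment \<omega> 1))"
    unfolding e_const_def Let_def scale ratio
    by (simp only: distrib_left right_diff_distrib mult_ac)
  \<comment> \<open>The odd extension of \<open>sqrt\<close> is multiplicative on all reals, so the
    factor comes out whatever the sign of the radicand.\<close>
  then show ?thesis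
    by (simp only: e_const_def Let_def real_sqrt_mult real_sqrt_abs)
qed

theorem lemma1p3:
  fixes \<omega> :: "(real^2) set"
  assumes "open \<omega>" and "bounded \<omega>" and "\<omega> \<noteq> {}"
  shows "is_norm (\<lambda>B. e_const B \<omega>) \<and>
    (\<forall>B. B \<noteq> 0 \<longrightarrow>
       e_const B \<omega> =
         sqrt (measure lebesgue \<omega>) * norm B *
         e_const (B /\<^sub>R norm B) ((\<lambda>x. (1 / sqrt (measure lebesgue \<omega>)) *\<^sub>R x) ` \<omega>))"
proof (intro conjI allI impI)
  show norm: "is_norm (\<lambda>B. e_const B \<omega>)"
    using is_norm_e_const[OF assms] .
  fix B :: "real^3"
  assume "B \<noteq> 0"
  have pos: "0 < sqrt (measure lebesgue \<omega>)"
    using measure_lebesgue_open_pos[OF assms] by simp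
  \<comment> \<open>Absolute homogeneity of the norm from (i), with a positive factor.\<close>
  have "e_const (B /\<^sub>R norm B) \<omega> = e_const B \<omega> / norm B"
    using norm by (simp add: is_norm_def divide_inverse mult.commute)
  then show "e_const B \<omega> =
      sqrt (measure lebesgue \<omega>) * norm B *
      e_const (B /\<^sub>R norm B) ((\<lambda>x. (1 / sqrt (measure lebesgue \<omega>)) *\<^sub>R x) ` \<omega>)"
    \<comment> \<open>The dilation contributes the reciprocal of
      \<open>sqrt (measure lebesgue \<omega>)\<close>, which cancels the prefactor.\<close>
    using pos \<open>B \<noteq> 0\<close>
    by (subst e_const_scaleR_image[OF assms(1)]) auto
qed

end
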